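(* Let $f,g:(a,b)\to\mathbb{R}$ be smooth functions with $f$ nowhere zero and $f'^2+g'^2=1$, and let $M^2$ be the surface of revolution in $E_1^3$ (with spacelike axis) parametrized by $$\boldsymbol{x}(s,\theta)=\big(f(s)\cosh\theta,\; g(s),\; f(s)\sinh\theta\big),\qquad s\in(a,b),\ \theta\in\mathbb{R}.$$ Assume that $M^2$ is non-degenerate with nowhere vanishing Gauss curvature. Then there exists a real $3\times 3$ matrix $A$ with $\Delta^{III}\boldsymbol{x}=A\boldsymbol{x}$ on $M^2$ if and only if one of the following holds: (i) $M^2$ is (an open part of) the pseudosphere $S^2_1(c)$ of real radius $c$, for some $c>0$; (ii) $M^2$ has zero mean curvature (identically).
   Context: $E_1^3$ is $\mathbb{R}^3$ with coordinates $(x,y,z)$ and the Lorentzian metric $\langle\cdot,\cdot\rangle=dx^2+dy^2-dz^2$. For a parametrized surface $\boldsymbol{x}(s,\theta)$ in $E_1^3$, put $E=\langle \boldsymbol{x}_s,\boldsymbol{x}_s\rangle$, $F=\langle \boldsymbol{x}_s,\boldsymbol{x}_\theta\rangle$, $G=\langle \boldsymbol{x}_\theta,\boldsymbol{x}_\theta\rangle$. The surface is non-degenerate if $EG-F^2\neq 0$ everywhere; then $\boldsymbol{n}$ denotes a unit normal field ($\langle\boldsymbol{n},\boldsymbol{n}\rangle=\pm1$), and the second fundamental form has coefficients $L=\langle \boldsymbol{x}_{ss},\boldsymbol{n}\rangle$, $M=\langle \boldsymbol{x}_{s\theta},\boldsymbol{n}\rangle$, $N=\langle \boldsymbol{x}_{\theta\theta},\boldsymbol{n}\rangle$.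 Nowhere vanishing Gauss curvature means $LN-M^2\neq0$ everywhere (no parabolic points). Zero mean curvature means $EN-2FM+GL=0$ identically. The third fundamental form $III$ has coefficients $e_{11}=\langle\boldsymbol{n}_s,\boldsymbol{n}_s\rangle$, $e_{12}=e_{21}=\langle\boldsymbol{n}_s,\boldsymbol{n}_\theta\rangle$, $e_{22}=\langle\boldsymbol{n}_\theta,\boldsymbol{n}_\theta\rangle$; it is non-degenerate when $LN-M^2\ne0$. With $e=\det(e_{km})$, $(e^{km})$ the inverse matrix of $(e_{km})$ and $(u^1,u^2)=(s,\theta)$, the Laplace operator with respect to $III$ is $$\Delta^{III}p=-\frac{1}{\sqrt{|e|}}\sum_{k,m}\frac{\partial}{\partial u^m}\Big(\sqrt{|e|}\,e^{km}\frac{\partial p}{\partial u^k}\Big)$$ for smooth functions $p$, and $\Delta^{III}\boldsymbol{x}$ is defined componentwise. $S_1^2(c)=\{x^2+y^2-z^2=c^2\}$. *)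

theory Defs
  imports "HOL-Analysis.Analysis"
begin

(* Meant for open I, where the iterated derivatives at a point of I depend only on
   the restriction of f to I. *)
definition smooth_on :: "real set \<Rightarrow> (real \<Rightarrow> real) \<Rightarrow> bool" where
  "smooth_on I f \<longleftrightarrow> (\<forall>k. \<forall>s\<in>I. (deriv ^^ k) f differentiable (at s))"

definition lorentz :: "real^3 \<Rightarrow> real^3 \<Rightarrow> real" where
  "lorentz v w = v$1 * w$1 + v$2 * w$2 - v$3 * w$3"

(* Partial derivative with respect to u^k, where (u^1, u^2) = (s, \<theta>). *)
definition pd :: "2 \<Rightarrow> (real \<Rightarrow> real \<Rightarrow> 'a) \<Rightarrow> real \<Rightarrow> real \<Rightarrow> 'a::real_normed_vector" where
  "pd k p s \<theta> = (if k = 1 then vector_derivative (\<lambda>t. p t \<theta>) (at s)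
                          else vector_derivative (\<lambda>t. p s t) (at \<theta>))"

definition ff1 :: "(real \<Rightarrow> real \<Rightarrow> real^3) \<Rightarrow> real \<Rightarrow> real \<Rightarrow> real^2^2" where
  "ff1 X s \<theta> = (\<chi> k m. lorentz (pd k X s \<theta>) (pd m X s \<theta>))"

definition nondegenerate_on :: "(real \<times> real) set \<Rightarrow> (real \<Rightarrow> real \<Rightarrow> real^3) \<Rightarrow> bool" where
  "nondegenerate_on D X \<longleftrightarrow> (\<forall>(s, \<theta>)\<in>D. det (ff1 X s \<theta>) \<noteq> 0)"

(* For a smooth nondegenerate surface, a continuous unit normal field is smooth. *)
definition unit_normal_field ::
    "(real \<times> real) set \<Rightarrow> (real \<Rightarrow> real \<Rightarrow> real^3) \<Rightarrow> (real \<Rightarrow> real \<Rightarrow> real^3) \<Rightarrow> bool" where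
  "unit_normal_field D X n \<longleftrightarrow>
     continuous_on D (\<lambda>(s, \<theta>). n s \<theta>) \<and>
     (\<forall>(s, \<theta>)\<in>D. lorentz (n s \<theta>) (n s \<theta>) \<in> {1, -1} \<and>
                  (\<forall>k. lorentz (pd k X s \<theta>) (n s \<theta>) = 0))"

definition ff2 ::
    "(real \<Rightarrow> real \<Rightarrow> real^3) \<Rightarrow> (real \<Rightarrow> real \<Rightarrow> real^3) \<Rightarrow> real \<Rightarrow> real \<Rightarrow> real^2^2" where
  "ff2 X n s \<theta> = (\<chi> k m. lorentz (pd m (pd k X) s \<theta>) (n s \<theta>))"

definition nowhere_zero_Gauss_curvature_on ::
    "(real \<times> real) set \<Rightarrow> (real \<Rightarrow> real \<Rightarrow> real^3) \<Rightarrow> (real \<Rightarrow> real \<Rightarrow> real^3) \<Rightarrow> bool" where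
  "nowhere_zero_Gauss_curvature_on D X n \<longleftrightarrow>
     (\<forall>(s, \<theta>)\<in>D. ff2 X n s \<theta> $1$1 * ff2 X n s \<theta> $2$2 - (ff2 X n s \<theta> $1$2)\<^sup>2 \<noteq> 0)"

definition zero_mean_curvature_on ::
    "(real \<times> real) set \<Rightarrow> (real \<Rightarrow> real \<Rightarrow> real^3) \<Rightarrow> (real \<Rightarrow> real \<Rightarrow> real^3) \<Rightarrow> bool" where
  "zero_mean_curvature_on D X n \<longleftrightarrow>
     (\<forall>(s, \<theta>)\<in>D. ff1 X s \<theta> $1$1 * ff2 X n s \<theta> $2$2
                  - 2 * ff1 X s \<theta> $1$2 * ff2 X n s \<theta> $1$2
                  + ff1 X s \<theta> $2$2 * ff2 X n s \<theta> $1$1 = 0)"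

definition ff3 :: "(real \<Rightarrow> real \<Rightarrow> real^3) \<Rightarrow> real \<Rightarrow> real \<Rightarrow> real^2^2" where
  "ff3 n s \<theta> = (\<chi> k m. lorentz (pd k n s \<theta>) (pd m n s \<theta>))"

definition laplace3 ::
    "(real \<Rightarrow> real \<Rightarrow> real^3) \<Rightarrow> (real \<Rightarrow> real \<Rightarrow> real) \<Rightarrow> real \<Rightarrow> real \<Rightarrow> real" where
  "laplace3 n p s \<theta> =
     - (1 / sqrt \<bar>det (ff3 n s \<theta>)\<bar>) *
       (\<Sum>k\<in>UNIV. \<Sum>m\<in>UNIV.
          pd m (\<lambda>s \<theta>. sqrt \<bar>det (ff3 n s \<theta>)\<bar> * matrix_inv (ff3 n s \<theta>) $k$m * pd k p s \<theta>) s \<theta>)"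

definition laplace3_vec ::
    "(real \<Rightarrow> real \<Rightarrow> real^3) \<Rightarrow> (real \<Rightarrow> real \<Rightarrow> real^3) \<Rightarrow> real \<Rightarrow> real \<Rightarrow> real^3" where
  "laplace3_vec n X s \<theta> = (\<chi> i. laplace3 n (\<lambda>s \<theta>. X s \<theta> $ i) s \<theta>)"

definition revolution :: "(real \<Rightarrow> real) \<Rightarrow> (real \<Rightarrow> real) \<Rightarrow> real \<Rightarrow> real \<Rightarrow> real^3" where
  "revolution f g s \<theta> = vector [f s * cosh \<theta>, g s, f s * sinh \<theta>]"

definition pseudosphere :: "real \<Rightarrow> (real^3) set" where
  "pseudosphere c = {v. lorentz v v = c\<^sup>2}"

end

theory Submission
  imports Defs
begin

text \<open>
  Write \<open>\<kappa>\<close> for the curvature of the profile curve \<open>(f, g)\<close> and \<open>\<rho> = 1/\<kappa> + f/g'\<close> for the sum of the two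
  principal radii of curvature of the surface.  A unit normal is, up to a constant sign,
  \<open>\<nu> = (g' cosh \<theta>, - f', g' sinh \<theta>)\<close>, the second fundamental form is \<open>- \<kappa> ds\<^sup>2 + f g' d\<theta>\<^sup>2\<close> and
  the third is \<open>\<kappa>\<^sup>2 ds\<^sup>2 - g'\<^sup>2 d\<theta>\<^sup>2\<close>, so that the curvature hypothesis says that \<open>\<kappa>\<close> and \<open>g'\<close> have
  no zeros.  Separating variables in the Laplacian gives \<open>\<Delta>x = \<rho> \<nu> - (\<rho>'/\<kappa>) x\<^sub>s\<close>
  (\<open>laplace3_vec_X\<close>).  Zero mean curvature is \<open>\<rho> = 0\<close>, whence \<open>\<Delta>x = 0\<close>; on a pseudosphere of
  radius \<open>c\<close> one finds \<open>\<rho>\<close> constant and \<open>\<Delta>x = 2 x\<close>.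

  Conversely, since \<open>cosh \<theta>\<close>, \<open>1\<close> and \<open>sinh \<theta>\<close> are linearly independent, a matrix \<open>A\<close> with
  \<open>\<Delta>x = A x\<close> may be taken to be \<open>diag(\<alpha>, \<beta>, \<alpha>)\<close> (\<open>coordinate_matrix_iff\<close>), and the equation says
  that \<open>f\<close> and \<open>g\<close> are eigenfunctions with eigenvalues \<open>\<alpha>\<close> and \<open>\<beta>\<close>.  Decomposed along the normal and
  the tangent of the profile curve it determines \<open>\<rho>\<close> and \<open>\<rho>'/\<kappa>\<close>; the compatibility of the two is
  \<open>(\<alpha> - \<beta>) f' g' / \<kappa> = - 2 (\<alpha> f f' + \<beta> g g')\<close> (\<open>eigen_relations\<close>).  If \<open>\<alpha> = \<beta> = 0\<close> then \<open>\<rho> = 0\<close>; if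
  \<open>\<alpha> = \<beta> \<noteq> 0\<close> then \<open>f\<^sup>2 + g\<^sup>2\<close> is constant and the surface lies on a pseudosphere.

  The main step excludes \<open>\<alpha> \<noteq> \<beta>\<close> (\<open>eigenvalues_equal\<close>).  Eliminating \<open>1/\<kappa>\<close> leaves a linear homogeneous
  relation between \<open>f\<close> and \<open>g\<close> whose coefficients are polynomials in \<open>f'\<close> and \<open>g'\<close>.  Its derivative along
  the curve is a second one, with coefficients rational in \<open>f'\<close> and \<open>g'\<close>.  As \<open>f \<noteq> 0\<close>, the determinant
  of the two vanishes, and up to the factor \<open>\<beta>\<close> it is a quadratic polynomial in \<open>g'\<^sup>2\<close>.  Since
  \<open>\<kappa> \<noteq> 0\<close>, \<open>g'\<^sup>2\<close> takes infinitely many values, so all three coefficients vanish, which is impossible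
  for \<open>\<beta> \<noteq> 0\<close>.  For \<open>\<beta> = 0\<close> the first relation alone is a contradiction, by the same argument.
\<close>

section \<open>Calculus preliminaries\<close>

lemma nonzero_constant_sign:
  fixes h :: "'a::topological_space \<Rightarrow> real"
  assumes "connected S" "continuous_on S h" "\<And>x. x \<in> S \<Longrightarrow> h x \<noteq> 0"
  obtains \<sigma> where "\<sigma> \<in> {1, -1}" "\<And>x. x \<in> S \<Longrightarrow> \<bar>h x\<bar> = \<sigma> * h x"
proof -
  have conn: "connected (h ` S)"
    using connected_continuous_image[OF assms(2,1)] .
  have "(\<forall>x\<in>S. h x > 0) \<or> (\<forall>x\<in>S. h x < 0)"
  proof (rule ccontr)
    assume "\<not> ?thesis"
    then obtain x y where "x \<in> S" "y \<in> S" "h x \<le> 0" "h y \<ge> 0"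
      by (meson not_less)
    then have "0 \<in> h ` S"
      using connectedD_interval[OF conn, of "h x" "h y" 0] by auto
    then show False
      using assms(3) by auto
  qed
  then show thesis
    using that[of 1] that[of "-1"] by fastforce
qed

lemma zero_derivative_on_open_set:
  fixes h :: "real \<Rightarrow> real"
  assumes "open S" "s \<in> S" "\<And>t. t \<in> S \<Longrightarrow> h t = 0" "(h has_real_derivative d) (at s)"
  shows "d = 0"
proof -
  have "((\<lambda>_. 0) has_real_derivative d) (at s)"
    using has_field_derivative_transform_within_open[OF assms(4,1,2)] assms(3) by simp
  then show ?thesis
    using DERIV_unique[OF _ DERIV_const[of 0]] by blast
qed

lemma has_vector_derivative_vector_3:
  assumes "(p has_real_derivative p') F" "(q has_real_derivative q') F"
    "(r has_real_derivative r') F"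
  shows "((\<lambda>t. vector [p t, q t, r t] :: real^3) has_vector_derivative vector [p', q', r']) F"
proof -
  have split: "(vector [x, y, z] :: real^3)
      = x *\<^sub>R vector [1, 0, 0] + y *\<^sub>R vector [0, 1, 0] + z *\<^sub>R vector [0, 0, 1]" for x y z :: real
    by (simp add: vec_eq_iff forall_3)
  note scaleR_left = bounded_linear.has_vector_derivative[OF bounded_linear_scaleR_left]
  show ?thesis
    unfolding split[of p'] split[of "p _"]
    using assms unfolding has_real_derivative_iff_has_vector_derivative
    by (intro has_vector_derivative_add scaleR_left)
qed

lemma matrix_inv_diagonal_2:
  fixes M :: "real^2^2"
  assumes "M $ 1 $ 2 = 0" "M $ 2 $ 1 = 0" "M $ 1 $ 1 \<noteq> 0" "M $ 2 $ 2 \<noteq> 0"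
  shows "matrix_inv M $ 1 $ 1 = 1 / M $ 1 $ 1" "matrix_inv M $ 2 $ 2 = 1 / M $ 2 $ 2"
    "matrix_inv M $ 1 $ 2 = 0" "matrix_inv M $ 2 $ 1 = 0"
proof -
  have "invertible M"
    using assms by (simp add: invertible_det_nz det_2)
  then have "M ** matrix_inv M = mat 1"
    unfolding invertible_def matrix_inv_def by (rule someI_ex[THEN conjunct1])
  then show "matrix_inv M $ 1 $ 1 = 1 / M $ 1 $ 1" "matrix_inv M $ 2 $ 2 = 1 / M $ 2 $ 2"
    "matrix_inv M $ 1 $ 2 = 0" "matrix_inv M $ 2 $ 1 = 0"
    using assms
    by (simp_all add: vec_eq_iff forall_2 matrix_matrix_mult_def sum_2 mat_def field_simps)
qed

lemma pd_cong_open: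
  assumes "open U" "(s, \<theta>) \<in> U" "\<And>t \<phi>. (t, \<phi>) \<in> U \<Longrightarrow> p t \<phi> = q t \<phi>"
  shows "pd k p s \<theta> = pd k q s \<theta>"
proof -
  have ev: "eventually (\<lambda>z. z \<in> U) (nhds (s, \<theta>))"
    using assms(1,2) eventually_nhds by blast
  have "(\<lambda>t. (t, \<theta>)) \<midarrow>s\<rightarrow> (s, \<theta>)" "(\<lambda>t. (s, t)) \<midarrow>\<theta>\<rightarrow> (s, \<theta>)"
    by (auto intro!: tendsto_eq_intros)
  then have "eventually (\<lambda>t. (t, \<theta>) \<in> U) (at s)" "eventually (\<lambda>t. (s, t) \<in> U) (at \<theta>)"
    using ev assms(1,2) by (auto simp: tendsto_def)
  then have "eventually (\<lambda>t. (t, \<theta>) \<in> U) (nhds s)" "eventually (\<lambda>t. (s, t) \<in> U) (nhds \<theta>)"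
    using assms(2) by (auto simp: eventually_nhds_conv_at)
  then show ?thesis
    unfolding pd_def
    by (auto intro!: vector_derivative_cong_eq elim!: eventually_mono simp: assms(3))
qed

lemma pd_1I: "((\<lambda>t. p t \<theta>) has_vector_derivative d) (at s) \<Longrightarrow> pd 1 p s \<theta> = d"
  by (simp add: pd_def vector_derivative_at)

lemma pd_2I: "((\<lambda>t. p s t) has_vector_derivative d) (at \<theta>) \<Longrightarrow> pd 2 p s \<theta> = d"
  by (simp add: pd_def vector_derivative_at)

lemma cosh_square_minus_sinh_square: "cosh x * cosh x - sinh x * sinh x = (1::real)"
  using cosh_square_eq[of x] by (simp add: power2_eq_square)

lemma quadratic_with_infinitely_many_zeros:
  fixes a b c :: real
  assumes "infinite T" "\<And>t. t \<in> T \<Longrightarrow> a * t\<^sup>2 + b * t + c = 0"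
  shows "a = 0" "b = 0" "c = 0"
proof -
  have "infinite {t. poly [:c, b, a:] t = 0}"
    by (rule infinite_super[OF _ assms(1)])
      (use assms(2) in \<open>auto simp: algebra_simps power2_eq_square\<close>)
  then have "[:c, b, a:] = 0"
    using poly_roots_finite by blast
  then show "a = 0" "b = 0" "c = 0"
    by simp_all
qed


section \<open>The geometry of the profile curve\<close>

locale profile_curve =
  fixes I :: "real set" and f g :: "real \<Rightarrow> real"
  assumes open_I: "open I" and connected_I: "connected I" and nonempty_I: "I \<noteq> {}"
    and smooth_f: "smooth_on I f" and smooth_g: "smooth_on I g"
    and f_nonzero: "s \<in> I \<Longrightarrow> f s \<noteq> 0"
    and unit_speed: "s \<in> I \<Longrightarrow> (deriv f s)\<^sup>2 + (deriv g s)\<^sup>2 = 1"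
begin

abbreviation f' where "f' \<equiv> deriv f"
abbreviation f'' where "f'' \<equiv> deriv f'"
abbreviation f''' where "f''' \<equiv> deriv f''"
abbreviation g' where "g' \<equiv> deriv g"
abbreviation g'' where "g'' \<equiv> deriv g'"
abbreviation g''' where "g''' \<equiv> deriv g''"
abbreviation D :: "(real \<times> real) set" where "D \<equiv> I \<times> UNIV"
abbreviation X where "X \<equiv> revolution f g"

lemma open_D: "open D"
  by (simp add: open_I open_Times)

lemma derivatives:
  assumes "s \<in> I"
  shows "(f has_real_derivative f' s) (at s)" "(f' has_real_derivative f'' s) (at s)"
    "(f'' has_real_derivative f''' s) (at s)"
    "(g has_real_derivative g' s) (at s)" "(g' has_real_derivative g'' s) (at s)"
    "(g'' has_real_derivative g''' s) (at s)"
proof -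
  have "((deriv ^^ k) f has_real_derivative deriv ((deriv ^^ k) f) s) (at s)"
    and "((deriv ^^ k) g has_real_derivative deriv ((deriv ^^ k) g) s) (at s)" for k
    using smooth_f smooth_g assms unfolding smooth_on_def
    by (auto simp: DERIV_deriv_iff_real_differentiable)
  from this[of 0] this[of 1] this[of 2] show
    "(f has_real_derivative f' s) (at s)" "(f' has_real_derivative f'' s) (at s)"
    "(f'' has_real_derivative f''' s) (at s)"
    "(g has_real_derivative g' s) (at s)" "(g' has_real_derivative g'' s) (at s)"
    "(g'' has_real_derivative g''' s) (at s)"
    by (simp_all add: numeral_2_eq_2)
qed

lemma unit_speed': "s \<in> I \<Longrightarrow> f' s * f' s + g' s * g' s = 1"
  using unit_speed by (simp add: power2_eq_square)

lemma continuous_on_profile: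
  "continuous_on I f" "continuous_on I f'" "continuous_on I f''"
  "continuous_on I g" "continuous_on I g'" "continuous_on I g''"
  by (rule continuous_at_imp_continuous_on, blast intro: DERIV_isCont derivatives)+

definition \<kappa> :: "real \<Rightarrow> real" where "\<kappa> s = f' s * g'' s - f'' s * g' s"

text \<open>
  The Frenet equations: the derivative of the unit tangent \<open>(f', g')\<close> is orthogonal to it, hence a
  multiple of \<open>(- g', f')\<close>, and \<open>\<kappa>\<close> is the factor.
\<close>

lemma frenet:
  assumes "s \<in> I"
  shows "f'' s = - \<kappa> s * g' s" "g'' s = \<kappa> s * f' s"
proof -
  have "((\<lambda>t. f' t * f' t + g' t * g' t - 1) has_real_derivative
      2 * (f' s * f'' s + g' s * g'' s)) (at s)"
    by (auto intro!: derivative_eq_intros derivatives assms)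
  then have "2 * (f' s * f'' s + g' s * g'' s) = 0"
    by (rule zero_derivative_on_open_set[OF open_I assms, rotated]) (simp add: unit_speed')
  then show "f'' s = - \<kappa> s * g' s" "g'' s = \<kappa> s * f' s"
    using unit_speed'[OF assms] unfolding \<kappa>_def by algebra+
qed

definition normal :: "real \<Rightarrow> real \<Rightarrow> real^3" where
  "normal s \<theta> = vector [g' s * cosh \<theta>, - f' s, g' s * sinh \<theta>]"

lemma pd_X:
  assumes "s \<in> I"
  shows "pd 1 X s \<theta> = vector [f' s * cosh \<theta>, g' s, f' s * sinh \<theta>]"
    "pd 2 X s \<theta> = vector [f s * sinh \<theta>, 0, f s * cosh \<theta>]"
  unfolding revolution_def
  by (auto intro!: pd_1I pd_2I has_vector_derivative_vector_3 derivative_eq_intros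
      derivatives assms)

lemma pd_pd_X:
  assumes "s \<in> I"
  shows "pd 1 (pd 1 X) s \<theta> = vector [f'' s * cosh \<theta>, g'' s, f'' s * sinh \<theta>]"
    "pd 2 (pd 1 X) s \<theta> = vector [f' s * sinh \<theta>, 0, f' s * cosh \<theta>]"
    "pd 2 (pd 2 X) s \<theta> = vector [f s * cosh \<theta>, 0, f s * sinh \<theta>]"
proof -
  have s: "(s, \<theta>) \<in> D"
    using assms by simp
  have X1: "pd k (pd 1 X) s \<theta> = pd k (\<lambda>s \<theta>. vector [f' s * cosh \<theta>, g' s, f' s * sinh \<theta>]) s \<theta>" for k
    by (rule pd_cong_open[OF open_D s]) (simp add: pd_X)
  have X2: "pd k (pd 2 X) s \<theta> = pd k (\<lambda>s \<theta>. vector [f s * sinh \<theta>, 0, f s * cosh \<theta>]) s \<theta>" for k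
    by (rule pd_cong_open[OF open_D s]) (simp add: pd_X)
  show "pd 1 (pd 1 X) s \<theta> = vector [f'' s * cosh \<theta>, g'' s, f'' s * sinh \<theta>]"
    "pd 2 (pd 1 X) s \<theta> = vector [f' s * sinh \<theta>, 0, f' s * cosh \<theta>]"
    "pd 2 (pd 2 X) s \<theta> = vector [f s * cosh \<theta>, 0, f s * sinh \<theta>]"
    unfolding X1 X2
    by (auto intro!: pd_1I pd_2I has_vector_derivative_vector_3 derivative_eq_intros
        derivatives assms)
qed

lemma ff1_X:
  assumes "s \<in> I"
  shows "ff1 X s \<theta> $ 1 $ 1 = 1" "ff1 X s \<theta> $ 1 $ 2 = 0" "ff1 X s \<theta> $ 2 $ 2 = - (f s)\<^sup>2"
  using unit_speed'[OF assms] cosh_square_minus_sinh_square[of \<theta>]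
  by (simp_all add: ff1_def pd_X[OF assms] lorentz_def power2_eq_square; algebra)+

text \<open>
  The two tangent vectors leave only a multiple of \<^term>\<open>normal\<close>, whose square is \<open>1\<close>, so the factor is
  \<open>1\<close> or \<open>- 1\<close> at each point; being continuous on the connected domain, it is constant.
\<close>

lemma unit_normal_field_eq_normal:
  assumes "unit_normal_field D X n"
  obtains \<epsilon> where "\<epsilon> \<in> {1, -1}" "\<And>s \<theta>. s \<in> I \<Longrightarrow> n s \<theta> = \<epsilon> *\<^sub>R normal s \<theta>"
proof -
  define h where "h = (\<lambda>(s, \<theta>). lorentz (n s \<theta>) (normal s \<theta>))"
  have n: "n s \<theta> = h (s, \<theta>) *\<^sub>R normal s \<theta>" "(h (s, \<theta>))\<^sup>2 = 1" if s: "s \<in> I" for s \<theta>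
  proof -
    define x y z where "x = n s \<theta> $ 1" and "y = n s \<theta> $ 2" and "z = n s \<theta> $ 3"
    define C S where "C = cosh \<theta>" and "S = sinh \<theta>"
    have CS: "C * C - S * S = 1" and uv: "f' s * f' s + g' s * g' s = 1"
      using cosh_square_minus_sinh_square unit_speed'[OF s] by (simp_all add: C_def S_def)
    have "lorentz (n s \<theta>) (n s \<theta>) \<in> {1, -1}"
      and "lorentz (pd 1 X s \<theta>) (n s \<theta>) = 0" and "lorentz (pd 2 X s \<theta>) (n s \<theta>) = 0"
      using assms s unfolding unit_normal_field_def by auto
    then have nn: "x * x + y * y - z * z \<in> {1, -1}"
      and n1: "f' s * C * x + g' s * y - f' s * S * z = 0"
      and "f s * S * x - f s * C * z = 0"
      by (simp_all add: lorentz_def pd_X[OF s] x_def y_def z_def C_def S_def)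
    then have n2: "S * x - C * z = 0"
      using f_nonzero[OF s] by algebra
    have h: "h (s, \<theta>) = x * (g' s * C) - y * f' s - z * (g' s * S)"
      by (simp add: h_def lorentz_def normal_def x_def y_def z_def C_def S_def)
    have xyz: "x = h (s, \<theta>) * (g' s * C)" "y = h (s, \<theta>) * (- f' s)" "z = h (s, \<theta>) * (g' s * S)"
      unfolding h using CS uv n1 n2 by algebra+
    then show "n s \<theta> = h (s, \<theta>) *\<^sub>R normal s \<theta>"
      by (simp add: vec_eq_iff forall_3 normal_def x_def y_def z_def C_def S_def)
    have "x * x + y * y - z * z = (h (s, \<theta>))\<^sup>2"
      using CS uv xyz by algebra
    then show "(h (s, \<theta>))\<^sup>2 = 1"
      using nn by (auto simp: power2_eq_square) (smt (verit) zero_le_square)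
  qed
  have "continuous_on D (\<lambda>z. n (fst z) (snd z))"
    using assms unfolding unit_normal_field_def by (simp add: case_prod_beta)
  then have "continuous_on D (\<lambda>z. h z)"
    unfolding h_def lorentz_def normal_def case_prod_beta
    by (auto intro!: continuous_intros
        continuous_on_compose2[OF continuous_on_profile(2)]
        continuous_on_compose2[OF continuous_on_profile(5)])
  moreover have "connected D"
    by (intro connected_Times connected_I connected_UNIV)
  moreover have "h z \<noteq> 0" if "z \<in> D" for z
    using n(2)[of "fst z" "snd z"] that by auto
  ultimately obtain \<sigma> where \<sigma>: "\<sigma> \<in> {1, -1}" "\<And>z. z \<in> D \<Longrightarrow> \<bar>h z\<bar> = \<sigma> * h z"
    using nonzero_constant_sign by blast
  show thesis
  proof (rule that[OF \<sigma>(1)])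
    fix s \<theta>
    assume s: "s \<in> I"
    have "\<bar>h (s, \<theta>)\<bar> = 1"
      using n(2)[OF s, of \<theta>] by (auto simp: power2_eq_1_iff)
    then have "h (s, \<theta>) = \<sigma>"
      using \<sigma> s by auto
    then show "n s \<theta> = \<sigma> *\<^sub>R normal s \<theta>"
      using n(1)[OF s] by simp
  qed
qed

end


text \<open>
  The sign \<open>\<epsilon>\<close> is the orientation of the given normal field.  It enters the second fundamental form
  linearly and cancels in the third.
\<close>

locale oriented_profile = profile_curve +
  fixes n :: "real \<Rightarrow> real \<Rightarrow> real^3" and \<epsilon> :: real
  assumes \<epsilon>: "\<epsilon> \<in> {1, -1}"
    and n_eq: "s \<in> I \<Longrightarrow> n s \<theta> = \<epsilon> *\<^sub>R normal s \<theta>"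
begin

lemma \<epsilon>_square: "\<epsilon> * \<epsilon> = 1"
  using \<epsilon> by auto

lemma pd_n:
  assumes "s \<in> I"
  shows "pd 1 n s \<theta> = vector [\<epsilon> * g'' s * cosh \<theta>, - \<epsilon> * f'' s, \<epsilon> * g'' s * sinh \<theta>]"
    "pd 2 n s \<theta> = vector [\<epsilon> * g' s * sinh \<theta>, 0, \<epsilon> * g' s * cosh \<theta>]"
proof -
  have s: "(s, \<theta>) \<in> D"
    using assms by simp
  have n: "pd k n s \<theta>
      = pd k (\<lambda>s \<theta>. vector [\<epsilon> * g' s * cosh \<theta>, - \<epsilon> * f' s, \<epsilon> * g' s * sinh \<theta>]) s \<theta>" for k
    by (rule pd_cong_open[OF open_D s]) (simp add: n_eq normal_def vec_eq_iff forall_3)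
  show "pd 1 n s \<theta> = vector [\<epsilon> * g'' s * cosh \<theta>, - \<epsilon> * f'' s, \<epsilon> * g'' s * sinh \<theta>]"
    "pd 2 n s \<theta> = vector [\<epsilon> * g' s * sinh \<theta>, 0, \<epsilon> * g' s * cosh \<theta>]"
    unfolding n
    by (auto intro!: pd_1I pd_2I has_vector_derivative_vector_3 derivative_eq_intros
        derivatives assms)
qed

lemma ff2_n:
  assumes "s \<in> I"
  shows "ff2 X n s \<theta> $ 1 $ 1 = - \<epsilon> * \<kappa> s" "ff2 X n s \<theta> $ 1 $ 2 = 0"
    "ff2 X n s \<theta> $ 2 $ 2 = \<epsilon> * f s * g' s"
  using unit_speed'[OF assms] cosh_square_minus_sinh_square[of \<theta>]
  by (simp_all add: ff2_def pd_pd_X[OF assms] lorentz_def frenet[OF assms] n_eq[OF assms]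
      normal_def; algebra)+

lemma ff3_n:
  assumes "s \<in> I"
  shows "ff3 n s \<theta> $ 1 $ 1 = (\<kappa> s)\<^sup>2" "ff3 n s \<theta> $ 1 $ 2 = 0"
    "ff3 n s \<theta> $ 2 $ 1 = 0" "ff3 n s \<theta> $ 2 $ 2 = - (g' s)\<^sup>2"
  using unit_speed'[OF assms] cosh_square_minus_sinh_square[of \<theta>] \<epsilon>_square
  by (simp_all add: ff3_def pd_n[OF assms] lorentz_def frenet[OF assms]; algebra)+

lemma zero_mean_curvature_iff:
  "zero_mean_curvature_on D X n \<longleftrightarrow> (\<forall>s\<in>I. g' s + f s * \<kappa> s = 0)"
proof -
  have "ff1 X s \<theta> $ 1 $ 1 * ff2 X n s \<theta> $ 2 $ 2 - 2 * ff1 X s \<theta> $ 1 $ 2 * ff2 X n s \<theta> $ 1 $ 2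
      + ff1 X s \<theta> $ 2 $ 2 * ff2 X n s \<theta> $ 1 $ 1 = \<epsilon> * f s * (g' s + f s * \<kappa> s)"
    if "s \<in> I" for s \<theta>
    by (simp add: ff1_X[OF that] ff2_n[OF that] algebra_simps power2_eq_square)
  moreover have "\<epsilon> * f s \<noteq> 0" if "s \<in> I" for s
    using \<epsilon> f_nonzero[OF that] by auto
  ultimately show ?thesis
    unfolding zero_mean_curvature_on_def by auto
qed

lemma nowhere_zero_Gauss_curvature_iff:
  "nowhere_zero_Gauss_curvature_on D X n \<longleftrightarrow> (\<forall>s\<in>I. \<kappa> s \<noteq> 0 \<and> g' s \<noteq> 0)"
proof -
  have "\<epsilon> \<noteq> 0"
    using \<epsilon> by auto
  then show ?thesis
    unfolding nowhere_zero_Gauss_curvature_on_def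
    by (auto simp: ff2_n f_nonzero)
qed

end


section \<open>The Laplacian of the third fundamental form\<close>

locale nonparabolic_profile = oriented_profile +
  assumes \<kappa>_nonzero: "s \<in> I \<Longrightarrow> \<kappa> s \<noteq> 0" and g'_nonzero: "s \<in> I \<Longrightarrow> g' s \<noteq> 0"
begin

definition radius :: "real \<Rightarrow> real" where "radius s = 1 / \<kappa> s"

text \<open>
  The principal curvatures with respect to \<^term>\<open>normal\<close> are \<open>- \<kappa>\<close> and \<open>- g'/f\<close>, so this is the sum of
  the principal radii up to sign: twice the mean curvature over the Gauss curvature.
\<close>

definition radii_sum :: "real \<Rightarrow> real" where "radii_sum s = radius s + f s / g' s"

lemma radius_derivative:
  assumes "s \<in> I"
  shows "(radius has_real_derivative deriv radius s) (at s)"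
proof -
  have "\<exists>d. (\<kappa> has_real_derivative d) (at s)"
    unfolding \<kappa>_def by (rule exI) (auto intro!: derivative_eq_intros derivatives assms)
  then obtain d where "(\<kappa> has_real_derivative d) (at s)" ..
  then have "((\<lambda>s. 1 / \<kappa> s) has_real_derivative (0 * \<kappa> s - 1 * d) / (\<kappa> s * \<kappa> s)) (at s)"
    by (intro DERIV_divide DERIV_const \<kappa>_nonzero assms)
  then have "\<exists>d. (radius has_real_derivative d) (at s)"
    unfolding radius_def by blast
  then show ?thesis
    by (metis DERIV_imp_deriv)
qed

lemma radii_sum_derivative:
  assumes "s \<in> I"
  shows "(radii_sum has_real_derivative
    deriv radius s + f' s / g' s - f s * \<kappa> s * f' s / (g' s)\<^sup>2) (at s)"
  unfolding radii_sum_def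
  by (auto intro!: derivative_eq_intros radius_derivative derivatives g'_nonzero assms
      simp: frenet[OF assms] field_simps power2_eq_square g'_nonzero[OF assms])

text \<open>
  The third fundamental form \<open>\<kappa>\<^sup>2 ds\<^sup>2 - g'\<^sup>2 d\<theta>\<^sup>2\<close> is diagonal with coefficients depending on \<open>s\<close>
  alone, and its volume density \<open>\<bar>\<kappa> g'\<bar>\<close> is \<open>\<kappa> g'\<close> up to one global sign, which cancels.  The Laplacian
  therefore acts separately on the two factors of a product.
\<close>

lemma laplace3_product:
  assumes s: "s \<in> I"
    and \<psi>: "\<And>t. t \<in> I \<Longrightarrow> (\<psi> has_real_derivative \<psi>' t) (at t)" "(\<psi>' has_real_derivative \<psi>'') (at s)"
    and \<omega>: "\<And>\<phi>. (\<omega> has_real_derivative \<omega>' \<phi>) (at \<phi>)" "(\<omega>' has_real_derivative \<omega>'') (at \<theta>)"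
  shows "laplace3 n (\<lambda>s \<theta>. \<psi> s * \<omega> \<theta>) s \<theta> =
    - (radius s / g' s) * (g'' s * radius s * \<psi>' s + g' s * deriv radius s * \<psi>' s
        + g' s * radius s * \<psi>'') * \<omega> \<theta>
    + \<psi> s * \<omega>'' / (g' s)\<^sup>2"
proof -
  have "continuous_on I (\<lambda>s. \<kappa> s * g' s)"
    unfolding \<kappa>_def by (intro continuous_intros continuous_on_profile)
  moreover have "\<kappa> t * g' t \<noteq> 0" if "t \<in> I" for t
    using \<kappa>_nonzero g'_nonzero that by simp
  ultimately obtain \<sigma> where \<sigma>: "\<sigma> \<in> {1, -1}" "\<And>t. t \<in> I \<Longrightarrow> \<bar>\<kappa> t * g' t\<bar> = \<sigma> * (\<kappa> t * g' t)"
    using nonzero_constant_sign[OF connected_I, of "\<lambda>s. \<kappa> s * g' s"] by blast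
  have vol: "sqrt \<bar>det (ff3 n t \<phi>)\<bar> = \<sigma> * (\<kappa> t * g' t)" if t: "t \<in> I" for t \<phi>
  proof -
    have "det (ff3 n t \<phi>) = - (\<kappa> t * g' t)\<^sup>2"
      by (simp add: det_2 ff3_n[OF t] power_mult_distrib)
    then show ?thesis
      using \<sigma>(2)[OF t] by simp
  qed
  have inv: "matrix_inv (ff3 n t \<phi>) $ 1 $ 1 = 1 / (\<kappa> t)\<^sup>2"
    "matrix_inv (ff3 n t \<phi>) $ 2 $ 2 = - 1 / (g' t)\<^sup>2"
    "matrix_inv (ff3 n t \<phi>) $ 1 $ 2 = 0" "matrix_inv (ff3 n t \<phi>) $ 2 $ 1 = 0" if t: "t \<in> I" for t \<phi>
    using matrix_inv_diagonal_2[of "ff3 n t \<phi>"] \<kappa>_nonzero[OF t] g'_nonzero[OF t]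
    by (simp_all add: ff3_n[OF t])
  have p1: "pd 1 (\<lambda>s \<theta>. \<psi> s * \<omega> \<theta>) t \<phi> = \<psi>' t * \<omega> \<phi>" if "t \<in> I" for t \<phi>
    by (rule pd_1I)
      (auto intro!: derivative_eq_intros \<psi> that simp flip: has_real_derivative_iff_has_vector_derivative)
  have p2: "pd 2 (\<lambda>s \<theta>. \<psi> s * \<omega> \<theta>) t \<phi> = \<psi> t * \<omega>' \<phi>" for t \<phi>
    by (rule pd_2I)
      (auto intro!: derivative_eq_intros \<omega> simp flip: has_real_derivative_iff_has_vector_derivative)
  define W where "W k m = (\<lambda>t \<phi>. sqrt \<bar>det (ff3 n t \<phi>)\<bar> * matrix_inv (ff3 n t \<phi>) $ k $ m
    * pd k (\<lambda>s \<theta>. \<psi> s * \<omega> \<theta>) t \<phi>)" for k m :: 2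
  have sD: "(s, \<theta>) \<in> D"
    using s by simp
  have "pd 1 (W 1 1) s \<theta> = pd 1 (\<lambda>t \<phi>. \<sigma> * (g' t * radius t * \<psi>' t) * \<omega> \<phi>) s \<theta>"
    by (rule pd_cong_open[OF open_D sD])
      (clarsimp simp: W_def vol inv p1, simp add: radius_def \<kappa>_nonzero power2_eq_square)
  also have "\<dots> = \<sigma> * (g'' s * radius s * \<psi>' s + g' s * deriv radius s * \<psi>' s
      + g' s * radius s * \<psi>'') * \<omega> \<theta>"
    by (rule pd_1I)
      (auto intro!: derivative_eq_intros \<psi> derivatives radius_derivative s
        simp flip: has_real_derivative_iff_has_vector_derivative simp: g'_nonzero algebra_simps)
  finally have W11: "pd 1 (W 1 1) s \<theta> = \<dots>" .
  have "pd 2 (W 2 2) s \<theta> = pd 2 (\<lambda>t \<phi>. - \<sigma> * (\<kappa> t / g' t * \<psi> t) * \<omega>' \<phi>) s \<theta>"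
    by (rule pd_cong_open[OF open_D sD])
      (clarsimp simp: W_def vol inv p2, simp add: g'_nonzero power2_eq_square)
  also have "\<dots> = - \<sigma> * (\<kappa> s / g' s * \<psi> s) * \<omega>''"
    by (rule pd_2I)
      (auto intro!: derivative_eq_intros \<omega>
        simp flip: has_real_derivative_iff_has_vector_derivative simp: g'_nonzero[OF s] algebra_simps)
  finally have W22: "pd 2 (W 2 2) s \<theta> = \<dots>" .
  have "pd 2 (W 1 2) s \<theta> = pd 2 (\<lambda>t \<phi>. 0) s \<theta>" "pd 1 (W 2 1) s \<theta> = pd 1 (\<lambda>t \<phi>. 0) s \<theta>"
    by (rule pd_cong_open[OF open_D sD]; simp add: W_def inv)+
  then have W0: "pd 2 (W 1 2) s \<theta> = 0" "pd 1 (W 2 1) s \<theta> = 0"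
    by (simp_all add: pd_def)
  have "laplace3 n (\<lambda>s \<theta>. \<psi> s * \<omega> \<theta>) s \<theta> =
      - (1 / (\<sigma> * (\<kappa> s * g' s))) * (pd 1 (W 1 1) s \<theta> + pd 2 (W 2 2) s \<theta>)"
    unfolding laplace3_def W_def[symmetric] by (simp add: sum_2 W0 vol s)
  moreover have "- (1 / (\<sigma> * (\<kappa> s * g' s))) * (\<sigma> * A * \<omega> \<theta> + - \<sigma> * (\<kappa> s / g' s * \<psi> s) * \<omega>'')
      = - (radius s / g' s) * A * \<omega> \<theta> + \<psi> s * \<omega>'' / (g' s)\<^sup>2" for A
  proof -
    have "\<sigma> \<noteq> 0"
      using \<sigma>(1) by auto
    then show ?thesis
      using \<kappa>_nonzero[OF s] g'_nonzero[OF s] by (simp add: radius_def field_simps power2_eq_square)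
  qed
  ultimately show ?thesis
    unfolding W11 W22 by simp
qed

text \<open>
  The profile of the Laplacian of the position vector.  The two formulas are the components of
  \<open>\<rho> \<nu> - (\<rho>'/\<kappa>) T\<close>, where \<open>\<rho>\<close> is \<^term>\<open>radii_sum\<close>, \<open>\<nu> = (g', - f')\<close> and \<open>T = (f', g')\<close>.
\<close>

definition \<Delta>f :: "real \<Rightarrow> real" where
  "\<Delta>f s = g' s * radii_sum s - f' s * radius s * deriv radii_sum s"

definition \<Delta>g :: "real \<Rightarrow> real" where
  "\<Delta>g s = - f' s * radii_sum s - g' s * radius s * deriv radii_sum s"

lemma laplace3_vec_X:
  assumes s: "s \<in> I"
  shows "laplace3_vec n X s \<theta> = vector [\<Delta>f s * cosh \<theta>, \<Delta>g s, \<Delta>f s * sinh \<theta>]"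
proof -
  define w where "w = 1 / g' s"
  have R: "radius s * \<kappa> s = 1" and w: "w * g' s = 1"
    by (simp_all add: w_def radius_def \<kappa>_nonzero g'_nonzero s)
  have uv: "f' s * f' s + g' s * g' s = 1"
    by (rule unit_speed'[OF s])
  have S: "radii_sum s = radius s + f s * w"
    "deriv radii_sum s = deriv radius s + f' s * w - f s * \<kappa> s * f' s * w\<^sup>2"
    using DERIV_imp_deriv[OF radii_sum_derivative[OF s]]
    by (simp_all add: radii_sum_def w_def power_divide)
  have f: "- (radius s / g' s) * (g'' s * radius s * f' s + g' s * deriv radius s * f' s
        + g' s * radius s * f'' s) * c + f s * c / (g' s)\<^sup>2 = \<Delta>f s * c" for c
  proof -
    have "- (radius s * w) * (\<kappa> s * f' s * radius s * f' s + g' s * deriv radius s * f' s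
        + g' s * radius s * (- \<kappa> s * g' s)) * c + f s * c * w\<^sup>2 = \<Delta>f s * c"
      unfolding \<Delta>f_def S using R w uv by algebra
    then show ?thesis
      by (simp add: w_def frenet[OF s] power_divide)
  qed
  have g: "- (radius s / g' s) * (g'' s * radius s * g' s + g' s * deriv radius s * g' s
        + g' s * radius s * g'' s) = \<Delta>g s"
  proof -
    have "- (radius s * w) * (\<kappa> s * f' s * radius s * g' s + g' s * deriv radius s * g' s
        + g' s * radius s * (\<kappa> s * f' s)) = \<Delta>g s"
      unfolding \<Delta>g_def S using R w uv by algebra
    then show ?thesis
      by (simp add: w_def frenet[OF s])
  qed
  have cosh': "(cosh has_real_derivative sinh \<phi>) (at \<phi>)"
    and sinh': "(sinh has_real_derivative cosh \<phi>) (at \<phi>)" for \<phi> :: real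
    by (auto intro!: derivative_eq_intros)
  have "laplace3 n (\<lambda>s \<theta>. X s \<theta> $ 1) s \<theta> = \<Delta>f s * cosh \<theta>"
    using laplace3_product[where \<theta>=\<theta>, OF s derivatives(1) derivatives(2)[OF s] cosh' sinh']
    unfolding revolution_def vector_3 f .
  moreover have "laplace3 n (\<lambda>s \<theta>. X s \<theta> $ 2) s \<theta> = \<Delta>g s"
    using laplace3_product[where \<theta>=\<theta> and \<omega>="\<lambda>_. 1" and \<omega>'="\<lambda>_. 0" and \<omega>''=0,
        OF s derivatives(4) derivatives(5)[OF s] DERIV_const DERIV_const]
    unfolding revolution_def vector_3 g by simp
  moreover have "laplace3 n (\<lambda>s \<theta>. X s \<theta> $ 3) s \<theta> = \<Delta>f s * sinh \<theta>"
    using laplace3_product[where \<theta>=\<theta>, OF s derivatives(1) derivatives(2)[OF s] sinh' cosh']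
    unfolding revolution_def vector_3 f .
  ultimately show ?thesis
    by (simp add: laplace3_vec_def vec_eq_iff forall_3)
qed


section \<open>Eigenfunction equations on the profile curve\<close>

text \<open>
  The functions \<open>cosh \<theta>\<close>, \<open>1\<close> and \<open>sinh \<theta>\<close> are linearly independent, so comparing coefficients at
  a fixed \<open>s\<close> leaves only the diagonal entries of the matrix.
\<close>

lemma coordinate_matrix_iff:
  "(\<exists>A :: real^3^3. \<forall>(s, \<theta>)\<in>D. laplace3_vec n X s \<theta> = A *v X s \<theta>) \<longleftrightarrow>
   (\<exists>\<alpha> \<beta>. \<forall>s\<in>I. \<Delta>f s = \<alpha> * f s \<and> \<Delta>g s = \<beta> * g s)"
proof
  assume "\<exists>A :: real^3^3. \<forall>(s, \<theta>)\<in>D. laplace3_vec n X s \<theta> = A *v X s \<theta>"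
  then obtain A :: "real^3^3" where
    A: "\<And>s \<theta>. s \<in> I \<Longrightarrow> laplace3_vec n X s \<theta> = A *v X s \<theta>"
    by auto
  have "\<Delta>f s = A $ 1 $ 1 * f s \<and> \<Delta>g s = A $ 2 $ 2 * g s" if s: "s \<in> I" for s
  proof -
    have eq: "\<Delta>f s * cosh \<theta> = A $ 1 $ 1 * (f s * cosh \<theta>) + A $ 1 $ 2 * g s + A $ 1 $ 3 * (f s * sinh \<theta>)"
      "\<Delta>g s = A $ 2 $ 1 * (f s * cosh \<theta>) + A $ 2 $ 2 * g s + A $ 2 $ 3 * (f s * sinh \<theta>)" for \<theta>
      using A[OF s, of \<theta>]
      by (simp_all add: laplace3_vec_X[OF s] revolution_def vec_eq_iff forall_3
          matrix_vector_mult_def sum_3)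
    have C: "cosh (1::real) - 1 \<noteq> 0"
      using cosh_real_nonneg_less_iff[of 0 1] by simp
    \<comment> \<open>The sum of the equations at \<open>1\<close> and \<open>- 1\<close> drops the \<open>sinh\<close> terms; subtracting a multiple of
        the one at \<open>0\<close> isolates the entries \<open>A\<^sub>1\<^sub>2\<close> and \<open>A\<^sub>2\<^sub>1\<close>.\<close>
    note at = eq[of 0, simplified] eq[of 1] eq[of "-1", simplified]
    have "A $ 1 $ 2 * g s * (cosh 1 - 1) = 0" "A $ 2 $ 1 * f s * (cosh 1 - 1) = 0"
      using at by algebra+
    then show ?thesis
      using C at(1,2) by simp
  qed
  then show "\<exists>\<alpha> \<beta>. \<forall>s\<in>I. \<Delta>f s = \<alpha> * f s \<and> \<Delta>g s = \<beta> * g s"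
    by blast
next
  assume "\<exists>\<alpha> \<beta>. \<forall>s\<in>I. \<Delta>f s = \<alpha> * f s \<and> \<Delta>g s = \<beta> * g s"
  then obtain \<alpha> \<beta> where "\<And>s. s \<in> I \<Longrightarrow> \<Delta>f s = \<alpha> * f s" "\<And>s. s \<in> I \<Longrightarrow> \<Delta>g s = \<beta> * g s"
    by auto
  then have "laplace3_vec n X s \<theta>
      = vector [vector [\<alpha>, 0, 0], vector [0, \<beta>, 0], vector [0, 0, \<alpha>]] *v X s \<theta>" if "s \<in> I" for s \<theta>
    using that
    by (simp add: laplace3_vec_X revolution_def vec_eq_iff forall_3 matrix_vector_mult_def sum_3)
  then show "\<exists>A :: real^3^3. \<forall>(s, \<theta>)\<in>D. laplace3_vec n X s \<theta> = A *v X s \<theta>"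
    by blast
qed

lemma zero_mean_curvature_iff_radii_sum:
  "zero_mean_curvature_on D X n \<longleftrightarrow> (\<forall>s\<in>I. radii_sum s = 0)"
proof -
  have "radii_sum s = (g' s + f s * \<kappa> s) / (\<kappa> s * g' s)" if "s \<in> I" for s
    using \<kappa>_nonzero[OF that] g'_nonzero[OF that]
    by (simp add: radii_sum_def radius_def field_simps)
  then show ?thesis
    unfolding zero_mean_curvature_iff by (auto simp: \<kappa>_nonzero g'_nonzero)
qed

lemma deriv_radii_sumI:
  assumes "s \<in> I" "\<And>t. t \<in> I \<Longrightarrow> radii_sum t = h t" "(h has_real_derivative d) (at s)"
  shows "deriv radii_sum s = d"
proof -
  have "(radii_sum has_real_derivative d) (at s)"
    using has_field_derivative_transform_within_open[OF assms(3) open_I assms(1)] assms(2) by simp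
  then show ?thesis
    by (rule DERIV_imp_deriv)
qed

text \<open>
  The components of \<open>(\<alpha> f, \<beta> g) = \<rho> \<nu> - (\<rho>'/\<kappa>) T\<close> along \<open>\<nu>\<close> and \<open>T\<close> give \<open>\<rho>\<close> and \<open>\<rho>'/\<kappa>\<close>.  The first
  conclusion is the former; the second compares the derivative of the former with the latter.
\<close>

lemma eigen_relations:
  assumes eigen: "\<forall>s\<in>I. \<Delta>f s = \<alpha> * f s \<and> \<Delta>g s = \<beta> * g s"
    and s: "s \<in> I"
  shows "radii_sum s = \<alpha> * f s * g' s - \<beta> * g s * f' s"
    "radius s * (\<alpha> - \<beta>) * f' s * g' s = - 2 * (\<alpha> * f s * f' s + \<beta> * g s * g' s)"
proof -
  have sum: "radii_sum t = \<alpha> * f t * g' t - \<beta> * g t * f' t"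
    and drift: "radius t * deriv radii_sum t = - (\<alpha> * f t * f' t + \<beta> * g t * g' t)" if "t \<in> I" for t
    using eigen[rule_format, OF that] unit_speed'[OF that] unfolding \<Delta>f_def \<Delta>g_def by algebra+
  have "deriv radii_sum s = \<alpha> * f' s * g' s + \<alpha> * f s * g'' s - \<beta> * g' s * f' s - \<beta> * g s * f'' s"
    by (rule deriv_radii_sumI[OF s sum])
      (auto intro!: derivative_eq_intros derivatives s simp: algebra_simps)
  moreover have "radius s * \<kappa> s = 1"
    by (simp add: radius_def \<kappa>_nonzero s)
  ultimately show "radius s * (\<alpha> - \<beta>) * f' s * g' s = - 2 * (\<alpha> * f s * f' s + \<beta> * g s * g' s)"
    using drift[OF s] frenet[OF s] by algebra
  show "radii_sum s = \<alpha> * f s * g' s - \<beta> * g s * f' s"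
    by (rule sum[OF s])
qed

text \<open>
  This turns an identity polynomial in \<open>g'\<^sup>2\<close> that holds along the curve into identities between its
  coefficients.  Were the set of values finite, \<open>g'\<^sup>2\<close> would be constant on the connected
  \<open>I\<close>, so \<open>g' g'' = \<kappa> f' g'\<close> would vanish, hence \<open>f'\<close>, and then \<open>f'' = - \<kappa> g'\<close>.
\<close>

lemma infinite_squared_slopes: "infinite ((\<lambda>s. (g' s)\<^sup>2) ` I)"
proof
  assume fin: "finite ((\<lambda>s. (g' s)\<^sup>2) ` I)"
  have "connected ((\<lambda>s. (g' s)\<^sup>2) ` I)"
    by (intro connected_continuous_image continuous_intros continuous_on_profile connected_I)
  then obtain k where k: "(\<lambda>s. (g' s)\<^sup>2) ` I = {k}"
    using fin nonempty_I by (auto simp: connected_finite_iff_sing)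
  have "f' s = 0" if s: "s \<in> I" for s
  proof -
    have "((\<lambda>s. (g' s)\<^sup>2 - k) has_real_derivative 2 * g' s * g'' s) (at s)"
      by (auto intro!: derivative_eq_intros derivatives s)
    then have "2 * g' s * g'' s = 0"
      by (rule zero_derivative_on_open_set[OF open_I s, rotated]) (use k in auto)
    then show ?thesis
      using frenet[OF s] \<kappa>_nonzero[OF s] g'_nonzero[OF s] by simp
  qed
  moreover obtain s where s: "s \<in> I"
    using nonempty_I by auto
  ultimately have "f'' s = 0"
    using zero_derivative_on_open_set[OF open_I s] derivatives(2)[OF s] by blast
  then show False
    using frenet[OF s] \<kappa>_nonzero[OF s] g'_nonzero[OF s] by simp
qed

text \<open>
  For \<open>\<alpha> \<noteq> \<beta>\<close> the curve would satisfy two linear homogeneous equations \<open>a f + b g = 0\<close> and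
  \<open>a\<^sub>2 f + b\<^sub>2 g = 0\<close>, the second being the derivative of the first with respect to the tangent angle.
  Their determinant vanishes because \<open>f \<noteq> 0\<close>, and by \<open>f'\<^sup>2 = 1 - g'\<^sup>2\<close> it is \<open>\<beta>\<close> times a quadratic
  polynomial in \<open>g'\<^sup>2\<close> with leading coefficient \<open>(\<alpha> - \<beta>)\<^sup>2 \<alpha>\<close>.  For \<open>\<beta> \<noteq> 0\<close> its coefficients
  force \<open>\<alpha> = 0\<close>, then \<open>\<beta> = 2\<close>, and finally \<open>\<beta> = - 4\<close>.  For \<open>\<beta> = 0\<close> the determinant says nothing, but
  then \<open>b = 0\<close> and the first equation alone is contradictory.
\<close>

lemma eigenvalues_equal:
  assumes eigen: "\<forall>s\<in>I. \<Delta>f s = \<alpha> * f s \<and> \<Delta>g s = \<beta> * g s"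
  shows "\<alpha> = \<beta>"
proof (rule ccontr)
  assume "\<alpha> \<noteq> \<beta>"
  define \<delta> \<sigma> where "\<delta> = \<alpha> - \<beta>" and "\<sigma> = \<alpha> + \<beta>"
  have \<delta>: "\<delta> \<noteq> 0"
    using \<open>\<alpha> \<noteq> \<beta>\<close> by (simp add: \<delta>_def)
  have w: "1 / g' s * g' s = 1" and R\<kappa>: "radius s * \<kappa> s = 1" if "s \<in> I" for s
    using \<kappa>_nonzero[OF that] g'_nonzero[OF that] by (simp_all add: radius_def)
  have R: "radius s = \<alpha> * f s * g' s - \<beta> * g s * f' s - f s * (1 / g' s)" if "s \<in> I" for s
    using eigen_relations(1)[OF eigen that] by (simp add: radii_sum_def)
  \<comment> \<open>The compatibility relation is linear in \<open>f\<close>, \<open>g\<close> and \<open>1/\<kappa>\<close>; substituting the formula just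
      found for \<open>1/\<kappa>\<close> leaves a linear relation between \<open>f\<close> and \<open>g\<close>.\<close>
  note compatibility = eigen_relations(2)[OF eigen]
  have linear: "f s * (f' s * (\<delta> * \<alpha> * (g' s)\<^sup>2 + \<sigma>)) + g s * (\<beta> * g' s * (2 - \<delta> * (f' s)\<^sup>2)) = 0"
    if "s \<in> I" for s
    using R[OF that] compatibility[OF that] w[OF that] unfolding \<delta>_def \<sigma>_def by algebra
  show False
  proof (cases "\<beta> = 0")
    case True
    have "- \<alpha> * ((g' s)\<^sup>2)\<^sup>2 + (\<alpha> - 1) * (g' s)\<^sup>2 + 1 = 0" if s: "s \<in> I" for s
    proof -
      have "f s * f' s * \<alpha> * (\<alpha> * (g' s)\<^sup>2 + 1) = 0"
        using linear[OF s] True unfolding \<delta>_def \<sigma>_def by algebra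
      moreover have "\<alpha> \<noteq> 0"
        using \<delta> True by (simp add: \<delta>_def)
      ultimately have "f' s * (\<alpha> * (g' s)\<^sup>2 + 1) = 0"
        using f_nonzero[OF s] by simp
      then show ?thesis
        using unit_speed[OF s] by algebra
    qed
    then have poly: "- \<alpha> * t\<^sup>2 + (\<alpha> - 1) * t + 1 = 0" if "t \<in> (\<lambda>s. (g' s)\<^sup>2) ` I" for t
      using that by blast
    show False
      using quadratic_with_infinitely_many_zeros(3)[OF infinite_squared_slopes poly] by simp
  next
    case False
    (* The coefficients of t and of 1 in the determinant divided by \<beta>, where t = g'^2. *)
    define q1 where "q1 = \<delta> * \<alpha> * (2 - \<delta>) + \<sigma> * \<delta> + 2 * \<delta>\<^sup>2 * (\<alpha> - 1) - 2 * (\<alpha> - 1) * (\<delta>\<^sup>2 - \<delta>)"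
    define q0 where "q0 = \<sigma> * (2 - \<delta>) - 2 * (\<alpha> - 1) * \<sigma>"
    have "\<delta>\<^sup>2 * \<alpha> * ((g' s)\<^sup>2)\<^sup>2 + q1 * (g' s)\<^sup>2 + q0 = 0" if s: "s \<in> I" for s
    proof -
      define u v w where "u = f' s" and "v = g' s" and "w = 1 / g' s"
      define a b where "a = u * (\<delta> * \<alpha> * v\<^sup>2 + \<sigma>)" and "b = \<beta> * v * (2 - \<delta> * u\<^sup>2)"
      (* (a', b') is the derivative of the relation (a, b) with respect to the tangent angle,
         where d/ds = \<kappa> d/d(angle), f and g have the derivatives u/\<kappa> and v/\<kappa>, and 1/\<kappa> has been
         replaced by its expression \<alpha> f v - \<beta> g u - f w. *)
      define a' where "a' = (u * a + v * b) * (\<alpha> * v - w) - v * (\<delta> * \<alpha> * v\<^sup>2 + \<sigma>) + 2 * u\<^sup>2 * \<delta> * \<alpha> * v"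
      define b' where "b' = - (u * a + v * b) * \<beta> * u + \<beta> * u * (2 - \<delta> * u\<^sup>2) + 2 * \<beta> * v\<^sup>2 * \<delta> * u"
      have ab: "f s * a + g s * b = 0"
        using linear[OF s] by (simp add: a_def b_def u_def v_def)
      have "((\<lambda>s. f s * (f' s * (\<delta> * \<alpha> * (g' s)\<^sup>2 + \<sigma>)) + g s * (\<beta> * g' s * (2 - \<delta> * (f' s)\<^sup>2)))
          has_real_derivative
            u * a + f s * (f'' s * (\<delta> * \<alpha> * v\<^sup>2 + \<sigma>) + u * (2 * \<delta> * \<alpha> * v * g'' s))
          + v * b + g s * (\<beta> * g'' s * (2 - \<delta> * u\<^sup>2) - \<beta> * v * (2 * \<delta> * u * f'' s))) (at s)"
        unfolding a_def b_def u_def v_def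
        by (auto intro!: derivative_eq_intros derivatives s simp: algebra_simps)
      then have "u * a + f s * (f'' s * (\<delta> * \<alpha> * v\<^sup>2 + \<sigma>) + u * (2 * \<delta> * \<alpha> * v * g'' s))
          + v * b + g s * (\<beta> * g'' s * (2 - \<delta> * u\<^sup>2) - \<beta> * v * (2 * \<delta> * u * f'' s)) = 0"
        by (rule zero_derivative_on_open_set[OF open_I s, rotated]) (rule linear)
      then have "(u * a + v * b) * radius s + f s * (- v * (\<delta> * \<alpha> * v\<^sup>2 + \<sigma>) + 2 * u\<^sup>2 * \<delta> * \<alpha> * v)
          + g s * (\<beta> * u * (2 - \<delta> * u\<^sup>2) + 2 * \<beta> * v\<^sup>2 * \<delta> * u) = 0"
        using R\<kappa>[OF s] frenet[OF s] unfolding u_def[symmetric] v_def[symmetric] by algebra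
      moreover have "radius s = \<alpha> * f s * v - \<beta> * g s * u - f s * w"
        using R[OF s] by (simp only: u_def v_def w_def)
      ultimately have ab': "f s * a' + g s * b' = 0"
        unfolding a'_def b'_def by algebra
      have "f s * (a * b' - b * a') = 0"
        using ab ab' by algebra
      then have "a * b' - b * a' = 0"
        using f_nonzero[OF s] by simp
      moreover have "a * b' - b * a' = \<beta> * (\<delta>\<^sup>2 * \<alpha> * (v\<^sup>2)\<^sup>2 + q1 * v\<^sup>2 + q0)"
      proof -
        have wv: "w * v = 1" and uv: "u\<^sup>2 = 1 - v\<^sup>2"
          using w[OF s] unit_speed[OF s] by (simp_all add: u_def v_def w_def)
        show ?thesis
          unfolding a'_def b'_def a_def b_def q1_def q0_def \<delta>_def \<sigma>_def
          using wv uv by algebra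
      qed
      ultimately show ?thesis
        using False by (simp add: v_def)
    qed
    then have "\<delta>\<^sup>2 * \<alpha> = 0" "q1 = 0" "q0 = 0"
      using quadratic_with_infinitely_many_zeros[OF infinite_squared_slopes, of "\<delta>\<^sup>2 * \<alpha>" q1 q0]
      by blast+
    moreover from this(1) have "\<alpha> = 0"
      using \<delta> by simp
    ultimately have "\<beta> * (2 - \<beta>) = 0" "\<beta> * (\<beta> + 4) = 0"
      unfolding q1_def q0_def \<delta>_def \<sigma>_def by algebra+
    then show False
      using False by simp
  qed
qed

lemma eigenfunctions_imp_minimal_or_circle:
  assumes eigen: "\<forall>s\<in>I. \<Delta>f s = \<alpha> * f s \<and> \<Delta>g s = \<beta> * g s"
  shows "(\<forall>s\<in>I. radii_sum s = 0) \<or> (\<exists>c>0. \<forall>s\<in>I. (f s)\<^sup>2 + (g s)\<^sup>2 = c\<^sup>2)"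
proof -
  have \<beta>: "\<beta> = \<alpha>"
    using eigenvalues_equal[OF eigen] by simp
  note rel = eigen_relations[OF eigen, unfolded \<beta>]
  show ?thesis
  proof (cases "\<alpha> = 0")
    case True
    then show ?thesis
      using rel(1) by simp
  next
    case False
    have "((\<lambda>s. (f s)\<^sup>2 + (g s)\<^sup>2) has_real_derivative 0) (at s within I)" if s: "s \<in> I" for s
    proof -
      have "((\<lambda>s. (f s)\<^sup>2 + (g s)\<^sup>2) has_real_derivative 2 * (f s * f' s + g s * g' s)) (at s)"
        by (auto intro!: derivative_eq_intros derivatives s)
      moreover have "f s * f' s + g s * g' s = 0"
        using rel(2)[OF s] False by algebra
      ultimately have "((\<lambda>s. (f s)\<^sup>2 + (g s)\<^sup>2) has_real_derivative 0) (at s)"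
        by (simp only: mult_zero_right)
      then show ?thesis
        by (rule has_field_derivative_at_within)
    qed
    moreover have "convex I"
      using connected_I by (simp add: connected_convex_1)
    ultimately have "\<exists>k. \<forall>s\<in>I. (f s)\<^sup>2 + (g s)\<^sup>2 = k"
      by (intro has_field_derivative_zero_constant)
    then obtain k where k: "\<And>s. s \<in> I \<Longrightarrow> (f s)\<^sup>2 + (g s)\<^sup>2 = k"
      by blast
    obtain s where "s \<in> I"
      using nonempty_I by auto
    then have "k > 0"
      using k[of s] f_nonzero[of s] by (auto intro: add_pos_nonneg)
    then show ?thesis
      using k by (intro disjI2 exI[of _ "sqrt k"]) simp
  qed
qed

lemma minimal_eigenfunctions:
  assumes "\<And>s. s \<in> I \<Longrightarrow> radii_sum s = 0" "s \<in> I"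
  shows "\<Delta>f s = 0" "\<Delta>g s = 0"
  using assms deriv_radii_sumI[OF assms(2), of "\<lambda>_. 0" 0] by (simp_all add: \<Delta>f_def \<Delta>g_def)

text \<open>
  On a circle about the origin, \<open>(f, g)\<close> is orthogonal to the tangent, so it is \<open>h \<nu>\<close> with
  \<open>\<nu> = (g', - f')\<close>.  Differentiating once more identifies \<open>h\<close> with the radius of curvature \<open>1/\<kappa>\<close>.
  Hence \<open>\<rho> = 2 h\<close> is constant, and \<open>\<rho> \<nu> = 2 (f, g)\<close>.
\<close>

lemma circle_eigenfunctions:
  assumes circle: "\<And>s. s \<in> I \<Longrightarrow> (f s)\<^sup>2 + (g s)\<^sup>2 = c\<^sup>2" and s: "s \<in> I"
  shows "\<Delta>f s = 2 * f s" "\<Delta>g s = 2 * g s"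
proof -
  have orth: "f t * f' t + g t * g' t = 0" if t: "t \<in> I" for t
  proof -
    have "((\<lambda>t. (f t)\<^sup>2 + (g t)\<^sup>2 - c\<^sup>2) has_real_derivative 2 * (f t * f' t + g t * g' t)) (at t)"
      by (auto intro!: derivative_eq_intros derivatives t)
    then have "2 * (f t * f' t + g t * g' t) = 0"
      by (rule zero_derivative_on_open_set[OF open_I t, rotated]) (simp add: circle)
    then show ?thesis
      by simp
  qed
  define h where "h t = f t * g' t - g t * f' t" for t
  have h: "f t = h t * g' t" "g t = - h t * f' t" if t: "t \<in> I" for t
    using orth[OF t] unit_speed'[OF t] unfolding h_def by algebra+
  have R: "radius t = h t" if t: "t \<in> I" for t
  proof -
    have "((\<lambda>t. f t * f' t + g t * g' t) has_real_derivative
        f' t * f' t + f t * f'' t + g' t * g' t + g t * g'' t) (at t)"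
      by (auto intro!: derivative_eq_intros derivatives t)
    then have "f' t * f' t + f t * f'' t + g' t * g' t + g t * g'' t = 0"
      by (rule zero_derivative_on_open_set[OF open_I t, rotated]) (rule orth)
    then have "h t * \<kappa> t = 1"
      using unit_speed'[OF t] frenet[OF t] unfolding h_def by algebra
    then show ?thesis
      using \<kappa>_nonzero[OF t] by (simp add: radius_def field_simps)
  qed
  have sum: "radii_sum t = 2 * h t" if t: "t \<in> I" for t
    using R[OF t] h(1)[OF t] g'_nonzero[OF t] by (simp add: radii_sum_def)
  have "((\<lambda>t. 2 * h t) has_real_derivative 2 * (f s * g'' s - g s * f'' s)) (at s)"
    unfolding h_def by (auto intro!: derivative_eq_intros derivatives s)
  then have "deriv radii_sum s = 2 * (f s * g'' s - g s * f'' s)"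
    using deriv_radii_sumI[OF s sum] by blast
  also have "\<dots> = 0"
    using orth[OF s] frenet[OF s] by algebra
  finally show "\<Delta>f s = 2 * f s" "\<Delta>g s = 2 * g s"
    using sum[OF s] h[OF s] by (simp_all add: \<Delta>f_def \<Delta>g_def)
qed

text \<open>
  Openness is automatic once the profile lies on the circle.  As \<open>g'\<close> has no zeros, \<open>g\<close> is injective with
  open range; hence the image of the surface is the part of the pseudosphere where the second
  coordinate lies in that range and the first has the sign of \<open>f\<close>: there \<open>s\<close> is found from
  the second coordinate and \<open>\<theta>\<close> from the hyperbola \<open>x\<^sup>2 - z\<^sup>2 = f\<^sup>2\<close>.
\<close>

lemma openin_pseudosphere_iff:
  assumes "c > 0"
  shows "openin (top_of_set (pseudosphere c)) ((\<lambda>(s, \<theta>). X s \<theta>) ` D) \<longleftrightarrow>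
    (\<forall>s\<in>I. (f s)\<^sup>2 + (g s)\<^sup>2 = c\<^sup>2)"
proof
  assume "openin (top_of_set (pseudosphere c)) ((\<lambda>(s, \<theta>). X s \<theta>) ` D)"
  then have sub: "(\<lambda>(s, \<theta>). X s \<theta>) ` D \<subseteq> pseudosphere c"
    by (rule openin_imp_subset)
  have "X s 0 \<in> pseudosphere c" if "s \<in> I" for s
    using sub that by auto
  then show "\<forall>s\<in>I. (f s)\<^sup>2 + (g s)\<^sup>2 = c\<^sup>2"
    by (simp add: pseudosphere_def lorentz_def revolution_def power2_eq_square)
next
  assume circle: "\<forall>s\<in>I. (f s)\<^sup>2 + (g s)\<^sup>2 = c\<^sup>2"
  obtain \<sigma> where \<sigma>: "\<sigma> \<in> {1, -1}" "\<And>s. s \<in> I \<Longrightarrow> \<bar>f s\<bar> = \<sigma> * f s"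
    using nonzero_constant_sign[OF connected_I continuous_on_profile(1)] f_nonzero by blast
  have g_neq: "g x \<noteq> g y" if "x \<in> I" "y \<in> I" "x < y" for x y
  proof
    assume "g x = g y"
    have xy: "{x..y} \<subseteq> I"
      using connected_contains_Icc[OF connected_I] that by blast
    then have "continuous_on {x..y} g"
      using continuous_on_profile(4) continuous_on_subset by blast
    moreover have "(g has_derivative (\<lambda>h. g' t * h)) (at t)" if "x < t" "t < y" for t
      using derivatives(4)[of t] xy that unfolding has_field_derivative_def
      by (meson atLeastAtMost_iff less_imp_le subsetD)
    ultimately obtain t where t: "x < t" "t < y" "(\<lambda>h. g' t * h) = (\<lambda>h. 0)"
      using Rolle_deriv[OF \<open>x < y\<close> \<open>g x = g y\<close>, of "\<lambda>t h. g' t * h"] by blast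
    then have "t \<in> I"
      using xy by auto
    then show False
      using fun_cong[OF t(3), of 1] g'_nonzero by simp
  qed
  have "inj_on g I"
    by (rule inj_onI) (metis g_neq linorder_neqE)
  then have open_gI: "open (g ` I)"
    using injective_eq_1d_open_map_UNIV[OF continuous_on_profile(4)] connected_I open_I
    by (simp add: is_interval_connected_1)
  define U where "U = {v :: real^3. v $ 2 \<in> g ` I} \<inter> {v. \<sigma> * v $ 1 > 0}"
  have "open U"
    unfolding U_def
    by (intro open_Int open_vimage[OF open_gI, unfolded vimage_def] open_Collect_less
        continuous_intros)
  moreover have "(\<lambda>(s, \<theta>). X s \<theta>) ` D = pseudosphere c \<inter> U"
  proof (intro equalityI subsetI)
    fix v
    assume "v \<in> (\<lambda>(s, \<theta>). X s \<theta>) ` D"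
    then obtain s \<theta> where s: "s \<in> I" and v: "v = X s \<theta>"
      by auto
    have "f s * cosh \<theta> * (f s * cosh \<theta>) + g s * g s - f s * sinh \<theta> * (f s * sinh \<theta>) = c\<^sup>2"
      using circle[rule_format, OF s] cosh_square_minus_sinh_square[of \<theta>] by algebra
    moreover have "\<sigma> * (f s * cosh \<theta>) > 0"
      using \<sigma>(2)[OF s] f_nonzero[OF s] by (metis cosh_real_pos mult.assoc mult_pos_pos zero_less_abs_iff)
    ultimately show "v \<in> pseudosphere c \<inter> U"
      using s by (auto simp: v U_def pseudosphere_def lorentz_def revolution_def)
  next
    fix v
    assume v: "v \<in> pseudosphere c \<inter> U"
    then obtain s where s: "s \<in> I" "v $ 2 = g s" and pos: "\<sigma> * v $ 1 > 0"
      by (auto simp: U_def)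
    define \<theta> where "\<theta> = arsinh (v $ 3 / f s)"
    have z: "v $ 3 = f s * sinh \<theta>"
      by (simp add: \<theta>_def f_nonzero[OF s(1)])
    have "v $ 1 * v $ 1 + v $ 2 * v $ 2 - v $ 3 * v $ 3 = c\<^sup>2"
      using v by (simp add: pseudosphere_def lorentz_def)
    then have "(v $ 1)\<^sup>2 = (f s * cosh \<theta>)\<^sup>2"
      using circle[rule_format, OF s(1)] s(2) z cosh_square_minus_sinh_square[of \<theta>] by algebra
    moreover have "\<sigma> * (f s * cosh \<theta>) > 0"
      using \<sigma>(2)[OF s(1)] f_nonzero[OF s(1)]
      by (metis cosh_real_pos mult.assoc mult_pos_pos zero_less_abs_iff)
    ultimately have "v $ 1 = f s * cosh \<theta>"
      using pos \<sigma>(1) by (auto simp: power2_eq_iff)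
    then have "v = X s \<theta>"
      by (simp add: revolution_def vec_eq_iff forall_3 s z)
    then show "v \<in> (\<lambda>(s, \<theta>). X s \<theta>) ` D"
      using s(1) by auto
  qed
  ultimately show "openin (top_of_set (pseudosphere c)) ((\<lambda>(s, \<theta>). X s \<theta>) ` D)"
    unfolding openin_open by blast
qed

theorem laplace3_coordinate_matrix_iff:
  "(\<exists>A :: real^3^3. \<forall>(s, \<theta>)\<in>D. laplace3_vec n X s \<theta> = A *v X s \<theta>) \<longleftrightarrow>
    (\<exists>c>0. openin (top_of_set (pseudosphere c)) ((\<lambda>(s, \<theta>). X s \<theta>) ` D)) \<or>
    zero_mean_curvature_on D X n"
proof -
  have "(\<exists>\<alpha> \<beta>. \<forall>s\<in>I. \<Delta>f s = \<alpha> * f s \<and> \<Delta>g s = \<beta> * g s) \<longleftrightarrow>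
    (\<exists>c>0. \<forall>s\<in>I. (f s)\<^sup>2 + (g s)\<^sup>2 = c\<^sup>2) \<or> (\<forall>s\<in>I. radii_sum s = 0)"
    (is "?eigen \<longleftrightarrow> ?circle \<or> ?minimal")
  proof
    assume ?eigen
    then show "?circle \<or> ?minimal"
      using eigenfunctions_imp_minimal_or_circle by blast
  next
    assume "?circle \<or> ?minimal"
    then show ?eigen
    proof
      assume ?circle
      then show ?eigen
        using circle_eigenfunctions by blast
    next
      assume ?minimal
      then show ?eigen
        using minimal_eigenfunctions by (intro exI[of _ 0]) simp
    qed
  qed
  then show ?thesis
    unfolding coordinate_matrix_iff zero_mean_curvature_iff_radii_sum
    using openin_pseudosphere_iff by auto
qed

end


section \<open>The classification\<close>

theorem theorem1:
  fixes a b :: ereal and f g :: "real \<Rightarrow> real"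
    and D :: "(real \<times> real) set" and X n :: "real \<Rightarrow> real \<Rightarrow> real^3"
  defines "D \<equiv> einterval a b \<times> UNIV"
    and "X \<equiv> revolution f g"
  assumes "a < b"
    and "smooth_on (einterval a b) f" and "smooth_on (einterval a b) g"
    and "\<forall>s\<in>einterval a b. f s \<noteq> 0"
    and "\<forall>s\<in>einterval a b. (deriv f s)\<^sup>2 + (deriv g s)\<^sup>2 = 1"
    and "nondegenerate_on D X"
    and "unit_normal_field D X n"
    and "nowhere_zero_Gauss_curvature_on D X n"
  shows "(\<exists>A :: real^3^3. \<forall>(s, \<theta>)\<in>D. laplace3_vec n X s \<theta> = A *v X s \<theta>) \<longleftrightarrow>
         (\<exists>c>0. openin (top_of_set (pseudosphere c)) ((\<lambda>(s, \<theta>). X s \<theta>) ` D)) \<or>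
         zero_mean_curvature_on D X n"
proof -
  have "is_interval (einterval a b)"
    unfolding is_interval_1 einterval_def
    by (metis (mono_tags, lifting) ereal_less_eq(3) less_le_trans le_less_trans mem_Collect_eq)
  then interpret profile_curve "einterval a b" f g
    using assms einterval_nonempty[of a b]
    by unfold_locales (auto simp: is_interval_connected)
  obtain \<epsilon> where \<epsilon>: "\<epsilon> \<in> {1, -1}" "\<And>s \<theta>. s \<in> einterval a b \<Longrightarrow> n s \<theta> = \<epsilon> *\<^sub>R normal s \<theta>"
    using unit_normal_field_eq_normal assms unfolding D_def X_def by blast
  interpret oriented_profile "einterval a b" f g n \<epsilon>
    using \<epsilon> by unfold_locales
  interpret nonparabolic_profile "einterval a b" f g n \<epsilon>
    using assms nowhere_zero_Gauss_curvature_iff unfolding D_def X_def by unfold_locales auto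
  show ?thesis
    unfolding D_def X_def by (rule laplace3_coordinate_matrix_iff)
qed

end
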